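(* Let $m_1,\dots,m_s$ be positive integers. For each positive integer $n$ let $$a_n=\frac{((m_1+m_2+\dots+m_s)n)!}{(m_1n)!\,(m_2n)!\cdots(m_sn)!}.$$ Then the sequence $(a_n)_{n\ge1}$ is not divisible.
   Context: A sequence $(a_n)_{n\ge1}$ of nonzero integers is called divisible if $n\mid n'$ implies $a_n\mid a_{n'}$ for all positive integers $n,n'$. The sequence $(a_n)$ in the claim is called the multinomial sequence with parameters $(m_1,\dots,m_s)$.
   Formalization: The formal theorem assumes at least two parameters (s ≥ 2); for s = 1 the sequence is constantly 1, which is divisible, so the statement fails there. *)

theory Defs
  imports Complex_Main
begin

definition divisible_seq :: "(nat \<Rightarrow> int) \<Rightarrow> bool" where
  "divisible_seq a \<longleftrightarrow> (\<forall>n n'. 1 \<le> n \<longrightarrow> 1 \<le> n' \<longrightarrow> n dvd n' \<longrightarrow> a n dvd a n')"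

(* The parameters are m 1, ..., m s.  The integer division is exact: see
   multinomial_seq_eq_quotient below. *)
definition multinomial_seq :: "nat \<Rightarrow> (nat \<Rightarrow> nat) \<Rightarrow> nat \<Rightarrow> int" where
  "multinomial_seq s m n = fact ((\<Sum>i=1..s. m i) * n) div (\<Prod>i=1..s. fact (m i * n))"

lemma prod_fact_dvd_fact_sum:
  fixes s n :: nat and m :: "nat \<Rightarrow> nat"
  shows "(\<Prod>i=1..s. fact (m i * n)) dvd (fact ((\<Sum>i=1..s. m i) * n) :: int)"
proof (induction s)
  case 0
  show ?case by simp
next
  case (Suc s)
  have "(\<Prod>i=1..Suc s. fact (m i * n)) = (\<Prod>i=1..s. fact (m i * n)) * (fact (m (Suc s) * n) :: int)"
    by simp
  also have "\<dots> dvd fact ((\<Sum>i=1..s. m i) * n) * fact (m (Suc s) * n)"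
    using Suc.IH by (rule mult_dvd_mono) simp
  also have "\<dots> dvd fact ((\<Sum>i=1..s. m i) * n + m (Suc s) * n)"
    by (rule fact_fact_dvd_fact)
  also have "(\<Sum>i=1..s. m i) * n + m (Suc s) * n = (\<Sum>i=1..Suc s. m i) * n"
    by (simp add: algebra_simps)
  finally show ?case .
qed

lemma multinomial_seq_eq_quotient:
  "of_int (multinomial_seq s m n)
     = (fact ((\<Sum>i=1..s. m i) * n) / (\<Prod>i=1..s. fact (m i * n)) :: rat)"
  unfolding multinomial_seq_def using prod_fact_dvd_fact_sum[where s = s and m = m and n = n]
  by (simp add: of_int_div of_int_prod)

lemma multinomial_seq_nonzero: "multinomial_seq s m n \<noteq> 0"
proof -
  have "(of_int (multinomial_seq s m n) :: rat) \<noteq> 0"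
    unfolding multinomial_seq_eq_quotient by simp
  then show ?thesis by simp
qed

(* For a single parameter the sequence is constantly 1, hence divisible. *)
lemma divisible_seq_multinomial_seq_1: "divisible_seq (multinomial_seq 1 m)"
  by (simp add: divisible_seq_def multinomial_seq_def)

end

theory Submission
  imports Defs "HOL-Computational_Algebra.Primes"
begin

text \<open>
  Put \<open>N = m\<^sub>1 + \<dots> + m\<^sub>s\<close>, let \<open>p > N\<^sup>2\<close> be a prime and let
  \<open>N n\<close> be the least multiple of \<open>N\<close> that is at least \<open>p\<close>, say \<open>N n = p + t\<close> with
  \<open>t < N\<close>.  Every \<open>m\<^sub>i n\<close> is less than \<open>p\<close> but \<open>p \<le> N n\<close>, so \<open>p\<close> divides \<open>a\<^sub>n\<close>.
  On the other hand the base-\<open>p\<close> digits of \<open>m\<^sub>i N n\<close> are \<open>m\<^sub>i\<close> and \<open>m\<^sub>i t\<close>, and they add up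
  without carries, so \<open>p\<close> does not divide \<open>a\<^bsub>N n\<^esub>\<close>.
\<close>

text \<open>Legendre's formula cut off after its first term: below \<open>p\<^sup>2\<close> every
  multiple of \<open>p\<close> contributes exactly one factor \<open>p\<close>.\<close>

lemma multiplicity_fact_less_square:
  fixes p k :: nat
  assumes p: "prime p" and "k < p\<^sup>2"
  shows "multiplicity (int p) (fact k) = k div p"
  using \<open>k < p\<^sup>2\<close>
proof (induction k)
  case 0
  show ?case by simp
next
  case (Suc k)
  have prime: "prime (int p)" using p by simp
  have "multiplicity (int p) (int (Suc k)) = (if p dvd Suc k then 1 else 0)"
  proof (cases "p dvd Suc k")
    case True
    moreover have "\<not> p\<^sup>2 dvd Suc k"
      using Suc.prems by (auto dest: dvd_imp_le)
    ultimately show ?thesis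
      by (intro multiplicity_eqI)
        (simp_all add: power2_eq_square flip: of_nat_mult of_nat_Suc)
  next
    case False
    then have "\<not> int p dvd int (Suc k)" by presburger
    with False show ?thesis by (simp add: not_dvd_imp_multiplicity_0 del: of_nat_Suc)
  qed
  moreover have "multiplicity (int p) (fact (Suc k))
      = multiplicity (int p) (int (Suc k)) + multiplicity (int p) (fact k)"
    using prime by (simp add: prime_elem_multiplicity_mult_distrib del: of_nat_Suc)
  moreover have "Suc k div p = (if p dvd Suc k then 1 else 0) + k div p"
    by (simp add: div_Suc dvd_eq_mod_eq_0)
  ultimately show ?case
    using Suc by simp
qed

text \<open>Written additively, so that no truncated subtraction on naturals arises.\<close>

lemma multiplicity_multinomial_seq:
  assumes p: "prime p" and bound: "(\<Sum>i=1..s. m i) * n < p\<^sup>2"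
  shows "multiplicity (int p) (multinomial_seq s m n) + (\<Sum>i=1..s. m i * n div p)
           = (\<Sum>i=1..s. m i) * n div p"
proof -
  have prime: "prime_elem (int p)" using p by simp
  have *: "m i * n < p\<^sup>2" if "i \<in> {1..s}" for i
  proof -
    have "m i \<le> (\<Sum>i=1..s. m i)"
      using that by (intro member_le_sum) auto
    then show ?thesis using bound by (meson le_less_trans mult_le_mono1)
  qed
  have "multinomial_seq s m n * (\<Prod>i=1..s. fact (m i * n)) = fact ((\<Sum>i=1..s. m i) * n)"
    unfolding multinomial_seq_def by (rule dvd_div_mult_self[OF prod_fact_dvd_fact_sum])
  then have "multiplicity (int p) (fact ((\<Sum>i=1..s. m i) * n))
      = multiplicity (int p) (multinomial_seq s m n)
        + multiplicity (int p) (\<Prod>i=1..s. fact (m i * n))"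
    using prime multinomial_seq_nonzero[of s m n]
    by (simp flip: prime_elem_multiplicity_mult_distrib)
  also have "multiplicity (int p) (\<Prod>i=1..s. fact (m i * n))
      = (\<Sum>i=1..s. multiplicity (int p) (fact (m i * n)))"
    using prime by (intro prime_elem_multiplicity_prod_distrib) auto
  also have "\<dots> = (\<Sum>i=1..s. m i * n div p)"
    using p * by (intro sum.cong refl multiplicity_fact_less_square) auto
  finally show ?thesis
    using p bound by (simp add: multiplicity_fact_less_square)
qed

theorem corollary5:
  fixes s :: nat and m :: "nat \<Rightarrow> nat"
  assumes "2 \<le> s"
    and "\<And>i. i \<in> {1..s} \<Longrightarrow> 0 < m i"
  shows "\<not> divisible_seq (multinomial_seq s m)"
proof
  assume div: "divisible_seq (multinomial_seq s m)"
  define N where "N = (\<Sum>i=1..s. m i)"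
  \<comment> \<open>Strict because \<open>2 \<le> s\<close> supplies a second index with a positive
    parameter.\<close>
  have m_less: "m i < N" if i: "i \<in> {1..s}" for i
  proof -
    obtain j where j: "j \<in> {1..s}" "j \<noteq> i"
      using assms(1) by (metis atLeastAtMost_iff le_refl one_le_numeral order_trans
          numeral_le_one_iff semiring_norm(69))
    have "m i + m j = sum m {i, j}" using j by simp
    also have "\<dots> \<le> N" unfolding N_def using i j by (intro sum_mono2) auto
    finally show ?thesis using assms(2)[OF j(1)] by simp
  qed
  have "0 < N" using m_less[of 1] assms(1) by simp
  obtain p where p: "prime p" "N\<^sup>2 < p" using bigger_prime by blast
  \<comment> \<open>This is \<open>p / N\<close> rounded up. With \<open>r = (p - 1) mod N\<close>
    one gets \<open>t = N - 1 - r\<close>.\<close>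
  define n where "n = Suc ((p - 1) div N)"
  define t where "t = N * n - p"
  have "0 < p" using p by (simp add: prime_gt_0_nat)
  have "p - 1 = N * ((p - 1) div N) + (p - 1) mod N" by simp
  moreover have "(p - 1) mod N < N" using \<open>0 < N\<close> by simp
  ultimately have Nn: "N * n = p + t" and "t < N"
    using \<open>0 < p\<close> unfolding t_def n_def mult_Suc_right by linarith+
  \<comment> \<open>The choice \<open>p > N\<^sup>2\<close> enters here: \<open>k * t < p\<close>
    for all \<open>k \<le> N\<close>, which rules out carries.\<close>
  have "N * t \<le> N\<^sup>2" using \<open>t < N\<close> by (simp add: power2_eq_square)
  then have "N * t < p" using p(2) by simp
  have "N < p" using p(2) \<open>0 < N\<close> by (metis le_less_trans le_square power2_eq_square)

  have "multiplicity (int p) (multinomial_seq s m n) = 1"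
  proof -
    \<comment> \<open>To get \<open>m i * n < p\<close> without dividing, compare both sides after
      multiplying by \<open>N\<close>.\<close>
    have "m i * n div p = 0" if i: "i \<in> {1..s}" for i
    proof -
      have "N * (m i * n) = m i * p + m i * t" using Nn by (metis distrib_left mult.left_commute)
      also have "\<dots> < m i * p + p"
        using m_less[OF i] \<open>N * t < p\<close> by (meson add_strict_left_mono le_less_trans less_imp_le mult_le_mono1)
      also have "\<dots> = Suc (m i) * p" by simp
      also have "\<dots> \<le> N * p" using m_less[OF i] by (intro mult_le_mono1) simp
      finally show ?thesis by simp
    qed
    moreover have "N * n div p = 1"
      using Nn \<open>t < N\<close> \<open>N < p\<close> by simp
    moreover have "N * n < p\<^sup>2"
    proof -
      have "N * n < 2 * p" using Nn \<open>t < N\<close> \<open>N < p\<close> by simp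
      also have "\<dots> \<le> p * p" using p(1) by (intro mult_le_mono1 prime_ge_2_nat)
      finally show ?thesis by (simp add: power2_eq_square)
    qed
    ultimately show ?thesis
      using multiplicity_multinomial_seq[of p m s n, folded N_def] p(1) by simp
  qed
  moreover have "multiplicity (int p) (multinomial_seq s m (N * n)) = 0"
  proof -
    \<comment> \<open>Used for each \<open>k = m i\<close> and for \<open>k = N\<close>; since the
      \<open>m i\<close> add up to \<open>N\<close>, the multiplicity vanishes.\<close>
    have digits: "k * (N * n) div p = k" if "k \<le> N" for k
    proof -
      have "k * t < p" using that \<open>N * t < p\<close> by (meson le_less_trans mult_le_mono1)
      then show ?thesis using \<open>0 < p\<close> by (simp add: Nn distrib_left)
    qed
    have "N * (N * n) < p\<^sup>2"
    proof -
      have "N * (N * n) < Suc N * p" using \<open>N * t < p\<close> by (simp add: Nn distrib_left)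
      also have "\<dots> \<le> p * p" using \<open>N < p\<close> by (intro mult_le_mono1) simp
      finally show ?thesis by (simp add: power2_eq_square)
    qed
    moreover have "(\<Sum>i=1..s. m i * (N * n) div p) = N"
      unfolding N_def[symmetric]
      by (subst N_def, intro sum.cong refl digits less_imp_le m_less)
    ultimately show ?thesis
      using multiplicity_multinomial_seq[of p m s "N * n", folded N_def] p(1) digits[of N]
      by simp
  qed
  moreover have "multinomial_seq s m n dvd multinomial_seq s m (N * n)"
  proof -
    have "1 \<le> n" "1 \<le> N * n" using \<open>0 < N\<close> by (simp_all add: n_def)
    then show ?thesis using div by (simp add: divisible_seq_def)
  qed
  \<comment> \<open>Nonzeroness matters, as \<open>multiplicity\<close> is 0 at 0 by
    convention.\<close>
  then have "multiplicity (int p) (multinomial_seq s m n)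
      \<le> multiplicity (int p) (multinomial_seq s m (N * n))"
    by (rule dvd_imp_multiplicity_le[OF _ multinomial_seq_nonzero])
  ultimately show False by simp
qed

end
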